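(* For arbitrary positive integers $m$ and $n$, the following identity holds in the field of rational functions $\mathbb{Q}(x_1,\ldots,x_n)$: $$\sum_{\lambda\subseteq \{m^n\}} s_{\lambda}(x_1,\ldots,x_n) = \frac{\det\big(x_i^{j-1}-x_i^{m+2n-j}\big)_{1\le i,j\le n}}{\det\big(x_i^{j-1}-x_i^{2n-j}\big)_{1\le i,j\le n}},$$ where the sum runs over all partitions $\lambda=(\lambda_1\ge \lambda_2\ge\cdots\ge\lambda_n\ge 0)$ with at most $n$ (nonzero) parts, each part at most $m$.
   Context: For a partition $\lambda=(\lambda_1\ge\cdots\ge\lambda_n\ge0)$, the Schur function in $n$ variables is $s_\lambda(x_1,\ldots,x_n)=\det\big(x_i^{\lambda_j+n-j}\big)_{1\le i,j\le n}\big/\prod_{1\le i<j\le n}(x_i-x_j)$ (equivalently, the sum over semistandard Young tableaux of shape $\lambda$ with entries in $\{1,\ldots,n\}$ of the corresponding monomials). The notation $\lambda\subseteq\{m^n\}$ means the Young diagram of $\lambda$ fits inside an $n\times m$ rectangle, i.e. $\lambda$ has at most $n$ parts and $\lambda_1\le m$. *)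

theory Defs
  imports
    "HOL-Library.Poly_Mapping"
    "HOL-Computational_Algebra.Fraction_Field"
    "Jordan_Normal_Form.Determinant"
begin

text \<open>
  A monomial is a finitely supported exponent vector and a polynomial is a finitely supported
  family of rational coefficients of monomials. The variables are indexed by all natural numbers,
  so \<open>ratfun\<close> is the field of rational functions in countably many variables; for each \<open>n\<close> it
  contains the field of rational functions in \<open>x\<^sub>1, \<dots>, x\<^sub>n\<close> as a subfield.
\<close>

type_synonym ratfun = "((nat \<Rightarrow>\<^sub>0 nat) \<Rightarrow>\<^sub>0 rat) fract"

definition X :: "nat \<Rightarrow> ratfun" where
  "X i = Fract (Poly_Mapping.single (Poly_Mapping.single i 1) 1) 1"

text \<open>The determinant with rows and columns indexed by \<open>1, \<dots>, n\<close> instead of \<open>0, \<dots>, n - 1\<close>.\<close>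

definition det1 :: "nat \<Rightarrow> (nat \<Rightarrow> nat \<Rightarrow> 'a) \<Rightarrow> 'a :: comm_ring_1" where
  "det1 n a = det (mat n n (\<lambda>(i, j). a (Suc i) (Suc j)))"

text \<open>
  A partition with at most \<open>n\<close> nonzero parts is a list of length exactly \<open>n\<close>, padded with zeros,
  and \<open>part \<lambda> j\<close> is \<open>\<lambda>\<^sub>j\<close> for \<open>1 \<le> j \<le> n\<close>.
\<close>

definition part :: "nat list \<Rightarrow> nat \<Rightarrow> nat" where
  "part lam j = lam ! (j - 1)"

definition box_partitions :: "nat \<Rightarrow> nat \<Rightarrow> nat list set" where
  "box_partitions m n = {lam. length lam = n \<and> sorted_wrt (\<ge>) lam \<and> (\<forall>k \<in> set lam. k \<le> m)}"

text \<open>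
  The bialternant formula. It gives the value of the Schur function only at pairwise distinct
  \<open>x 1, \<dots>, x n\<close>; otherwise the denominator vanishes.
\<close>

definition schur :: "nat \<Rightarrow> (nat \<Rightarrow> 'a) \<Rightarrow> nat list \<Rightarrow> 'a :: field" where
  "schur n x lam =
     det1 n (\<lambda>i j. x i ^ (part lam j + n - j)) /
     (\<Prod>(i, j) \<in> {(i, j). 1 \<le> i \<and> i < j \<and> j \<le> n}. x i - x j)"

end

theory Submission
  imports Defs
begin

text \<open>
  Write \<open>W(x) = \<Prod>i. (1 - x\<^sub>i) \<cdot> \<Prod>i<j. (x\<^sub>j - x\<^sub>i) (1 - x\<^sub>i x\<^sub>j)\<close>. Multilinearity in the rows turns
  \<open>det (x\<^sub>i\<^bsup>j\<^esup> - x\<^sub>i\<^bsup>m+2n-1-j\<^esup>)\<close>, \<open>0 \<le> i, j < n\<close>, into a sum of \<open>2\<^sup>n\<close> Vandermonde determinants in which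
  the variables indexed by a set \<open>S\<close> are inverted. Inverting \<open>x\<^sub>i\<close> multiplies \<open>W\<close> by \<open>- x\<^sub>i\<^bsup>1-2n\<^esup>\<close>, so
  the determinant equals \<open>W(x) H\<^sub>m(x)\<close>, where \<open>H\<^sub>m\<close> is the sum over all \<open>S\<close> of \<open>\<Prod>i\<in>S. x\<^sub>i\<^bsup>m\<^esup>\<close> times
  Littlewood's product \<open>\<Prod>i. 1 / (1 - y\<^sub>i) \<cdot> \<Prod>i<j. 1 / (1 - y\<^sub>i y\<^sub>j)\<close> in the partly inverted
  variables \<open>y\<close>. By Lagrange interpolation, \<open>H\<^sub>k(x) - H\<^bsub>k-1\<^esub>(x)\<close> is the sum over \<open>i\<close> of
  \<open>x\<^sub>i\<^bsup>k+n-1\<^esup> / \<Prod>j\<noteq>i. (x\<^sub>i - x\<^sub>j)\<close> times the value of \<open>H\<^sub>k\<close> at the variables other than \<open>x\<^sub>i\<close>. Induction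
  on \<open>n\<close> and expansion of the alternants along the first column show that this difference is the
  sum of the Schur functions over the partitions with largest part \<open>k\<close>. As \<open>H\<^bsub>-1\<^esub> = 0\<close>, summing over
  \<open>k \<le> m\<close> identifies \<open>H\<^sub>m\<close> with the sum over the box, and \<open>m = 0\<close> gives \<open>H\<^sub>0 = 1\<close>.
\<close>

section \<open>Products over ordered pairs\<close>

definition pairs_prod :: "('i :: linorder \<Rightarrow> 'i \<Rightarrow> 'a :: comm_monoid_mult) \<Rightarrow> 'i set \<Rightarrow> 'a" where
  "pairs_prod f I = (\<Prod>(i, j) \<in> {(i, j). i \<in> I \<and> j \<in> I \<and> i < j}. f i j)"

lemma finite_ordered_pairs: "finite I \<Longrightarrow> finite {(i, j). i \<in> I \<and> j \<in> I \<and> (i :: 'i :: linorder) < j}"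
  by (rule finite_subset[of _ "I \<times> I"]) auto

lemma pairs_prod_empty [simp]: "pairs_prod f {} = 1"
  by (simp add: pairs_prod_def)

lemma pairs_prod_cong:
  assumes "\<And>i j. i \<in> I \<Longrightarrow> j \<in> I \<Longrightarrow> i < j \<Longrightarrow> f i j = g i j"
  shows "pairs_prod f I = pairs_prod g I"
  unfolding pairs_prod_def by (rule prod.cong) (auto simp: assms)

lemma pairs_prod_mult: "pairs_prod (\<lambda>i j. f i j * g i j) I = pairs_prod f I * pairs_prod g I"
  unfolding pairs_prod_def by (simp add: prod.distrib split_def)

lemma pairs_prod_nonzero:
  fixes f :: "'i :: linorder \<Rightarrow> 'i \<Rightarrow> 'a :: semidom"
  assumes "finite I" and "\<And>i j. i \<in> I \<Longrightarrow> j \<in> I \<Longrightarrow> i < j \<Longrightarrow> f i j \<noteq> 0"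
  shows "pairs_prod f I \<noteq> 0"
  using assms finite_ordered_pairs[OF assms(1)] unfolding pairs_prod_def by auto

lemma pairs_prod_reindex:
  assumes "strict_mono s"
  shows "pairs_prod f (s ` I) = pairs_prod (\<lambda>i j. f (s i) (s j)) I"
proof -
  have "{(i, j). i \<in> s ` I \<and> j \<in> s ` I \<and> i < j} =
      map_prod s s ` {(i, j). i \<in> I \<and> j \<in> I \<and> i < j}"
    using strict_mono_less[OF assms] by (auto simp: image_iff)
  moreover have "inj_on (map_prod s s) A" for A
    using strict_mono_eq[OF assms] by (auto simp: inj_on_def)
  ultimately show ?thesis
    by (simp add: pairs_prod_def prod.reindex split_def)
qed

lemma pairs_prod_remove:
  assumes "finite I" and "i \<in> I"
  shows "pairs_prod f I =
    (\<Prod>j\<in>I - {i}. if j < i then f j i else f i j) * pairs_prod f (I - {i})"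
proof -
  let ?pairs_with_i = "{(a, b). a \<in> I \<and> b \<in> I \<and> a < b \<and> (a = i \<or> b = i)}"
  have "{(a, b). a \<in> I \<and> b \<in> I \<and> a < b} =
      ?pairs_with_i \<union> {(a, b). a \<in> I - {i} \<and> b \<in> I - {i} \<and> a < b}"
    using assms(2) by auto
  moreover have "finite ?pairs_with_i"
    by (rule finite_subset[OF _ finite_ordered_pairs[OF assms(1)]]) auto
  ultimately have "pairs_prod f I = (\<Prod>(a, b)\<in>?pairs_with_i. f a b) * pairs_prod f (I - {i})"
    using finite_ordered_pairs[of "I - {i}"] assms(1)
    unfolding pairs_prod_def by (simp only: finite_Diff) (rule prod.union_disjoint; auto)
  also have "(\<Prod>(a, b)\<in>?pairs_with_i. f a b) = (\<Prod>j\<in>I - {i}. if j < i then f j i else f i j)"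
    by (rule prod.reindex_bij_witness[of _ "\<lambda>j. if j < i then (j, i) else (i, j)"
          "\<lambda>(a, b). if a = i then b else a"]) (use assms(2) in \<open>auto split: if_splits\<close>)
  finally show ?thesis .
qed

lemma pairs_prod_remove_commute:
  assumes "finite I" and "i \<in> I" and "\<And>j k. f j k = f k j"
  shows "pairs_prod f I = (\<Prod>j\<in>I - {i}. f i j) * pairs_prod f (I - {i})"
proof -
  have "(if j < i then f j i else f i j) = f i j" for j using assms(3) by simp
  then show ?thesis using pairs_prod_remove[OF assms(1,2), of f] by simp
qed

lemma pairs_prod_mult_separate:
  assumes "finite I"
  shows "pairs_prod (\<lambda>i j. z i * z j) I = (\<Prod>i\<in>I. z i ^ (card I - 1))"
  using assms
proof (induction I)
  case empty
  show ?case by simp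
next
  case (insert i I)
  have "pairs_prod (\<lambda>i j. z i * z j) (insert i I) =
      (\<Prod>j\<in>I. z i * z j) * pairs_prod (\<lambda>i j. z i * z j) I"
    using pairs_prod_remove_commute[of "insert i I" i "\<lambda>i j. z i * z j"] insert.hyps
    by (simp add: mult.commute)
  also have "\<dots> = z i ^ card I * (\<Prod>j\<in>I. z j * z j ^ (card I - 1))"
    using insert by (simp add: prod.distrib mult.assoc)
  also have "(\<Prod>j\<in>I. z j * z j ^ (card I - 1)) = (\<Prod>j\<in>I. z j ^ card I)"
    using insert.hyps
    by (intro prod.cong refl) (metis card_gt_0_iff empty_iff power_eq_if neq0_conv)
  finally show ?case using insert.hyps by simp
qed

section \<open>Lagrange interpolation\<close>

lemma sum_poly_div_prod_diff:
  fixes p :: "'a :: field poly"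
  assumes "finite T" and "degree p < card T"
  shows "(\<Sum>t\<in>T. poly p t / (\<Prod>u\<in>T - {t}. t - u)) = coeff p (card T - 1)"
proof -
  define weight where "weight t = poly p t / (\<Prod>u\<in>T - {t}. t - u)" for t
  define node_poly where "node_poly t = (\<Prod>u\<in>T - {t}. [:- u, 1:])" for t
  define interpolant where "interpolant = (\<Sum>t\<in>T. smult (weight t) (node_poly t))"
  have degree_node_poly: "degree (node_poly t) = card T - 1" if "t \<in> T" for t
    using that assms(1) unfolding node_poly_def by (subst degree_prod_eq_sum_degree) auto
  have "lead_coeff (node_poly t) = 1" for t
    unfolding node_poly_def lead_coeff_prod by simp
  then have coeff_node_poly: "coeff (node_poly t) (card T - 1) = 1" if "t \<in> T" for t
    using degree_node_poly[OF that] by metis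
  have "degree interpolant \<le> card T - 1"
    unfolding interpolant_def using assms(1) degree_node_poly
    by (intro degree_sum_le) (auto intro: order.trans[OF degree_smult_le])
  then have "degree interpolant < card T" using assms(2) by linarith
  moreover have "poly p s = poly interpolant s" if s: "s \<in> T" for s
  proof -
    have "poly interpolant s = (\<Sum>t\<in>T. weight t * (\<Prod>u\<in>T - {t}. s - u))"
      by (simp add: interpolant_def node_poly_def poly_sum poly_prod)
    also have "\<dots> = (\<Sum>t\<in>{s}. weight t * (\<Prod>u\<in>T - {t}. s - u))"
      by (rule sum.mono_neutral_right) (use s assms(1) in auto)
    also have "\<dots> = poly p s"
      using assms(1) by (simp add: weight_def)
    finally show ?thesis by simp
  qed
  ultimately have "p = interpolant"
    using assms(2) by (intro poly_eqI_degree[of T])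
  then have "coeff p (card T - 1) = (\<Sum>t\<in>T. weight t * coeff (node_poly t) (card T - 1))"
    by (simp add: interpolant_def coeff_sum)
  also have "\<dots> = (\<Sum>t\<in>T. weight t)" using coeff_node_poly by (intro sum.cong) auto
  finally show ?thesis by (simp add: weight_def)
qed

lemma sum_prod_remove_reindex:
  fixes x :: "'i \<Rightarrow> 'b" and f :: "'b \<Rightarrow> 'a :: comm_semiring_1"
  assumes "inj_on x I"
  shows "(\<Sum>a\<in>x ` I. f a * (\<Prod>b\<in>x ` I - {a}. g a b)) =
    (\<Sum>i\<in>I. f (x i) * (\<Prod>j\<in>I - {i}. g (x i) (x j)))"
proof (subst sum.reindex[OF assms], intro sum.cong refl)
  fix i assume "i \<in> I"
  then have "x ` I - {x i} = x ` (I - {i})" using assms by (auto simp: inj_on_def)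
  moreover have "inj_on x (I - {i})" using assms by (rule inj_on_subset) blast
  ultimately show "((\<lambda>a. f a * (\<Prod>b\<in>x ` I - {a}. g a b)) \<circ> x) i =
      f (x i) * (\<Prod>j\<in>I - {i}. g (x i) (x j))"
    by (simp add: prod.reindex)
qed

lemma sum_power_div_prod_diff:
  fixes x :: "'i \<Rightarrow> 'a :: field"
  assumes "finite I" and "inj_on x I" and "I \<noteq> {}"
  shows "(\<Sum>i\<in>I. x i ^ (card I - 1) / (\<Prod>j\<in>I - {i}. x i - x j)) = 1"
proof -
  let ?p = "monom (1 :: 'a) (card I - 1)"
  have "degree ?p < card (x ` I)"
    using assms by (simp add: card_image card_gt_0_iff degree_monom_eq)
  then have "(\<Sum>a\<in>x ` I. a ^ (card I - 1) / (\<Prod>b\<in>x ` I - {a}. a - b)) = 1"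
    using sum_poly_div_prod_diff[of "x ` I" ?p] assms by (simp add: poly_monom card_image)
  then show ?thesis
    using sum_prod_remove_reindex[OF assms(2), of "\<lambda>a. a ^ (card I - 1)" "\<lambda>a b. inverse (a - b)"]
    by (simp add: divide_inverse prod_inversef[symmetric] o_def)
qed

text \<open>Interpolate \<open>\<Prod>b\<in>A. (b z - 1)\<close> at the nodes \<open>A\<close> and \<open>-1\<close>.\<close>

lemma sum_prod_mult_minus_1_div_diff:
  fixes A :: "'a :: field set"
  assumes "finite A" and "0 \<notin> A" and "-1 \<notin> A"
  shows "(\<Sum>a\<in>A. (a - 1) * (\<Prod>b\<in>A - {a}. (a * b - 1) / (a - b))) = \<Prod>A - 1"
proof -
  define p where "p = (\<Prod>b\<in>A. [:-1, b:])"
  have "degree [:-1, b:] = 1" if "b \<in> A" for b using that assms(2) by auto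
  then have degree_p: "degree p = card A"
    unfolding p_def using assms(1) by (subst degree_prod_eq_sum_degree) auto
  have "lead_coeff p = \<Prod>A"
    unfolding p_def lead_coeff_prod using assms(2) by (intro prod.cong) auto
  then have coeff_p: "coeff p (card A) = \<Prod>A" by (simp add: degree_p)
  have poly_p: "poly p a = (\<Prod>b\<in>A. a * b - 1)" for a
    by (simp add: p_def poly_prod)
  have "poly p a / (\<Prod>b\<in>insert (-1) A - {a}. a - b) =
      (a - 1) * (\<Prod>b\<in>A - {a}. (a * b - 1) / (a - b))" if a: "a \<in> A" for a
  proof -
    have "a + 1 \<noteq> 0" using a assms(3) by (metis add_eq_0_iff2)
    moreover have "insert (-1) A - {a} = insert (-1) (A - {a})"
      using a assms(3) by auto
    moreover have "a * a - 1 = (a - 1) * (a + 1)" by (simp add: algebra_simps)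
    ultimately show ?thesis
      using a assms(1,3) by (simp add: poly_p prod.remove[of A a] prod_dividef)
  qed
  moreover have "poly p (-1) / (\<Prod>b\<in>insert (-1) A - {-1}. - 1 - b) = 1"
  proof -
    have "poly p (-1) = (\<Prod>b\<in>A. - 1 - b)" unfolding poly_p by (intro prod.cong) auto
    moreover have "(\<Prod>b\<in>A. - 1 - b) \<noteq> 0"
      using assms(1,3) by (auto simp: diff_eq_eq)
    ultimately show ?thesis using assms(3) by simp
  qed
  ultimately have "(\<Sum>t\<in>insert (-1) A. poly p t / (\<Prod>u\<in>insert (-1) A - {t}. t - u)) =
      1 + (\<Sum>a\<in>A. (a - 1) * (\<Prod>b\<in>A - {a}. (a * b - 1) / (a - b)))"
    using assms(1,3) by (simp add: sum.insert)
  moreover have "(\<Sum>t\<in>insert (-1) A. poly p t / (\<Prod>u\<in>insert (-1) A - {t}. t - u)) = \<Prod>A"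
    using assms(1,3) degree_p coeff_p by (subst sum_poly_div_prod_diff) auto
  ultimately show ?thesis by (simp add: eq_diff_eq add.commute)
qed

section \<open>Littlewood sums over partly inverted variables\<close>

text \<open>The last condition includes \<open>i = j\<close>, so that the values \<open>1\<close> and \<open>-1\<close> are excluded.\<close>

definition generic_on :: "'i set \<Rightarrow> ('i \<Rightarrow> 'a :: field) \<Rightarrow> bool" where
  "generic_on I x \<longleftrightarrow> inj_on x I \<and> (\<forall>i\<in>I. x i \<noteq> 0) \<and> (\<forall>i\<in>I. \<forall>j\<in>I. x i * x j \<noteq> 1)"

lemma generic_onD:
  assumes "generic_on I x"
  shows "inj_on x I" and "i \<in> I \<Longrightarrow> x i \<noteq> 0" and "i \<in> I \<Longrightarrow> j \<in> I \<Longrightarrow> x i * x j \<noteq> 1"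
    and "i \<in> I \<Longrightarrow> x i \<noteq> 1" and "i \<in> I \<Longrightarrow> x i \<noteq> -1"
  using assms unfolding generic_on_def by (force+)

lemma generic_on_subset: "generic_on I x \<Longrightarrow> J \<subseteq> I \<Longrightarrow> generic_on J x"
  unfolding generic_on_def by (auto intro: inj_on_subset)

lemma generic_on_reindex: "inj_on s I \<Longrightarrow> generic_on (s ` I) x \<Longrightarrow> generic_on I (x \<circ> s)"
  unfolding generic_on_def by (auto intro: comp_inj_on)

definition invert_on :: "'i set \<Rightarrow> ('i \<Rightarrow> 'a :: field) \<Rightarrow> 'i \<Rightarrow> 'a" where
  "invert_on S x i = (if i \<in> S then inverse (x i) else x i)"

lemma generic_on_invert_on:
  assumes "generic_on I x"
  shows "generic_on I (invert_on S x)"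
proof -
  note generic = generic_onD[OF assms]
  have "inverse (x i) \<noteq> x j \<and> x i \<noteq> inverse (x j)" if "i \<in> I" "j \<in> I" for i j
    using generic(3)[OF that] generic(2)[OF that(1)] generic(2)[OF that(2)]
    by (metis left_inverse right_inverse)
  then have "inj_on (invert_on S x) I"
    using generic(1) unfolding inj_on_def invert_on_def by (auto simp: inverse_eq_iff_eq)
  moreover have "invert_on S x i * invert_on S x j \<noteq> 1" if "i \<in> I" "j \<in> I" for i j
  proof
    assume "invert_on S x i * invert_on S x j = 1"
    then have "x i * x j = 1 \<or> x i = x j"
      using generic(2)[OF that(1)] generic(2)[OF that(2)]
      by (auto simp: invert_on_def field_simps split: if_splits)
    then have "i = j" using generic(1,3) that unfolding inj_on_def by blast
    then show False
      using \<open>invert_on S x i * invert_on S x j = 1\<close> generic(3)[OF that(1,1)]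
      by (auto simp: invert_on_def simp flip: inverse_mult_distrib split: if_splits)
  qed
  ultimately show ?thesis
    using generic(2) by (simp add: generic_on_def invert_on_def)
qed

definition littlewood_denom :: "('i :: linorder \<Rightarrow> 'a :: comm_ring_1) \<Rightarrow> 'i set \<Rightarrow> 'a" where
  "littlewood_denom x I = (\<Prod>i\<in>I. 1 - x i) * pairs_prod (\<lambda>i j. 1 - x i * x j) I"

definition littlewood_summand :: "int \<Rightarrow> ('i :: linorder \<Rightarrow> 'a :: field) \<Rightarrow> 'i set \<Rightarrow> 'i set \<Rightarrow> 'a" where
  "littlewood_summand m x S I = (\<Prod>i\<in>S. x i powi m) / littlewood_denom (invert_on S x) I"

definition bounded_littlewood :: "int \<Rightarrow> ('i :: linorder \<Rightarrow> 'a :: field) \<Rightarrow> 'i set \<Rightarrow> 'a" where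
  "bounded_littlewood m x I = (\<Sum>S\<in>Pow I. littlewood_summand m x S I)"

lemma littlewood_denom_cong:
  "(\<And>i. i \<in> I \<Longrightarrow> x i = y i) \<Longrightarrow> littlewood_denom x I = littlewood_denom y I"
  unfolding littlewood_denom_def
  by (auto intro!: arg_cong2[of _ _ _ _ "(*)"] prod.cong pairs_prod_cong)

lemma littlewood_denom_reindex:
  assumes "strict_mono s"
  shows "littlewood_denom x (s ` I) = littlewood_denom (x \<circ> s) I"
  using strict_mono_imp_inj_on[OF assms] inj_on_subset
  by (fastforce simp: littlewood_denom_def pairs_prod_reindex[OF assms] prod.reindex)

lemma littlewood_denom_remove:
  assumes "finite I" and "i \<in> I"
  shows "littlewood_denom x I =
    (1 - x i) * (\<Prod>j\<in>I - {i}. 1 - x i * x j) * littlewood_denom x (I - {i})"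
  using pairs_prod_remove_commute[OF assms, of "\<lambda>i j. 1 - x i * x j"]
    prod.remove[OF assms, of "\<lambda>i. 1 - x i"]
  by (simp add: littlewood_denom_def mult.commute mult.left_commute)

lemma littlewood_denom_nonzero:
  assumes "finite I" and "generic_on I x"
  shows "littlewood_denom x I \<noteq> 0"
proof -
  have "pairs_prod (\<lambda>i j. 1 - x i * x j) I \<noteq> 0"
    using generic_onD(3)[OF assms(2)] by (intro pairs_prod_nonzero assms(1)) auto
  then show ?thesis
    using assms(1) generic_onD(4)[OF assms(2)] by (simp add: littlewood_denom_def)
qed

lemma littlewood_summand_reindex:
  fixes x :: "'i :: linorder \<Rightarrow> 'a :: field" and s :: "'j :: linorder \<Rightarrow> 'i"
  assumes "strict_mono s"
  shows "littlewood_summand m x (s ` S) (s ` I) = littlewood_summand m (x \<circ> s) S I"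
proof -
  have inj_s: "inj s" using assms by (rule strict_mono_imp_inj_on)
  then have "invert_on (s ` S) x \<circ> s = invert_on S (x \<circ> s)"
    by (auto simp: invert_on_def inj_image_mem_iff)
  moreover have "(\<Prod>i\<in>s ` S. x i powi m) = (\<Prod>i\<in>S. (x \<circ> s) i powi m)"
    using inj_on_subset[OF inj_s] by (simp add: prod.reindex)
  ultimately show ?thesis
    by (simp add: littlewood_summand_def littlewood_denom_reindex[OF assms])
qed

lemma bounded_littlewood_reindex:
  fixes x :: "'i :: linorder \<Rightarrow> 'a :: field" and s :: "'j :: linorder \<Rightarrow> 'i"
  assumes "strict_mono s"
  shows "bounded_littlewood m x (s ` I) = bounded_littlewood m (x \<circ> s) I"
proof -
  have "inj s" using assms by (rule strict_mono_imp_inj_on)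
  then have "inj_on ((`) s) (Pow I)" by (auto simp: inj_on_def inj_image_eq_iff)
  then show ?thesis
    unfolding bounded_littlewood_def image_Pow_surj[OF refl, symmetric]
    by (simp add: sum.reindex littlewood_summand_reindex[OF assms])
qed

lemma sum_Pow_remove_swap:
  assumes "finite I"
  shows "(\<Sum>S\<in>Pow I. \<Sum>i\<in>S. f i (S - {i})) = (\<Sum>i\<in>I. \<Sum>S\<in>Pow (I - {i}). f i S)"
proof -
  have "(\<Sum>S\<in>Pow I. \<Sum>i\<in>S. f i (S - {i})) = (\<Sum>(S, i)\<in>(SIGMA S:Pow I. S). f i (S - {i}))"
    using assms by (intro sum.Sigma) (auto intro: finite_subset)
  also have "\<dots> = (\<Sum>(i, S)\<in>(SIGMA i:I. Pow (I - {i})). f i S)"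
    by (rule sum.reindex_bij_witness[of _ "\<lambda>(i, S). (insert i S, i)" "\<lambda>(S, i). (i, S - {i})"]) auto
  also have "\<dots> = (\<Sum>i\<in>I. \<Sum>S\<in>Pow (I - {i}). f i S)"
    using assms by (intro sum.Sigma[symmetric]) auto
  finally show ?thesis .
qed

lemma prod_invert_on_div_prod_diff:
  fixes x :: "'i \<Rightarrow> 'a :: field"
  assumes "finite I" and "generic_on I x" and "S \<subseteq> I" and "i \<in> S"
  defines "y \<equiv> invert_on S x"
  shows "(\<Prod>j\<in>S. x j) * x i ^ (card I - 1) * ((1 - y i) * (\<Prod>j\<in>I - {i}. 1 - y i * y j)) /
      (\<Prod>j\<in>I - {i}. x i - x j) =
    (x i - 1) * (\<Prod>j\<in>S - {i}. (x i * x j - 1) / (x i - x j))"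
proof -
  note generic = generic_onD[OF assms(2)]
  have i: "i \<in> I" using assms(3,4) by blast
  have restrict: "(\<Prod>j\<in>S - {i}. f j) = (\<Prod>j\<in>I - {i}. if j \<in> S then f j else 1)"
    for f :: "'i \<Rightarrow> 'a"
  proof -
    have "(I - {i}) \<inter> S = S - {i}" using assms(3) by auto
    then show ?thesis using prod.inter_restrict[of "I - {i}" f S] assms(1) by simp
  qed
  have y_i: "y i = inverse (x i)" using assms(4) by (simp add: y_def invert_on_def)
  then have x_i_mult: "x i * (1 - y i) = x i - 1"
    using generic(2)[OF i] by (simp add: right_diff_distrib)
  have factor: "(if j \<in> S then x j else 1) * x i * (1 - y i * y j) / (x i - x j) =
      (if j \<in> S then (x i * x j - 1) / (x i - x j) else 1)" if j: "j \<in> I - {i}" for j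
  proof -
    have "x i - x j \<noteq> 0" using generic(1) i j by (auto simp: inj_on_def)
    then show ?thesis
      using generic(2)[OF i] generic(2)[of j] j
      unfolding y_i by (simp add: y_def invert_on_def field_simps)
  qed
  have "(\<Prod>j\<in>S. x j) = x i * (\<Prod>j\<in>I - {i}. if j \<in> S then x j else 1)"
    using prod.remove[OF finite_subset[OF assms(3,1)] assms(4)] by (simp only: restrict[symmetric])
  then have "(\<Prod>j\<in>S. x j) * x i ^ (card I - 1) * ((1 - y i) * (\<Prod>j\<in>I - {i}. 1 - y i * y j)) /
      (\<Prod>j\<in>I - {i}. x i - x j) =
      x i * (1 - y i) *
      (\<Prod>j\<in>I - {i}. (if j \<in> S then x j else 1) * x i * (1 - y i * y j) / (x i - x j))"
    using i by (simp add: prod.distrib prod_dividef)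
  also have "\<dots> = (x i - 1) * (\<Prod>j\<in>S - {i}. (x i * x j - 1) / (x i - x j))"
    unfolding x_i_mult restrict by (simp only: factor cong: prod.cong)
  finally show ?thesis .
qed

lemma prod_div_littlewood_denom_remove:
  fixes x :: "'i :: linorder \<Rightarrow> 'a :: field"
  assumes "finite I" and "generic_on I x" and "S \<subseteq> I" and "i \<in> S"
  shows "(\<Prod>j\<in>S. x j) * x i ^ (card I - 1) /
      ((\<Prod>j\<in>I - {i}. x i - x j) * littlewood_denom (invert_on S x) (I - {i})) =
    (x i - 1) * (\<Prod>j\<in>S - {i}. (x i * x j - 1) / (x i - x j)) / littlewood_denom (invert_on S x) I"
proof -
  let ?y = "invert_on S x"
  let ?removed = "(1 - ?y i) * (\<Prod>j\<in>I - {i}. 1 - ?y i * ?y j)"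
  have remove: "littlewood_denom ?y I = ?removed * littlewood_denom ?y (I - {i})"
    using assms by (intro littlewood_denom_remove) auto
  then have "?removed \<noteq> 0"
    using littlewood_denom_nonzero[OF assms(1) generic_on_invert_on[OF assms(2)], of S] by auto
  moreover have "a / (p * q) = a * e / p / (e * q)" if "e \<noteq> 0" for a p q e :: 'a
    using that by (simp add: mult_ac)
  ultimately show ?thesis
    unfolding prod_invert_on_div_prod_diff[OF assms, symmetric] remove by blast
qed

lemma prod_minus_1_div_littlewood_denom:
  fixes x :: "'i :: linorder \<Rightarrow> 'a :: field"
  assumes "finite I" and "generic_on I x" and "S \<subseteq> I"
  shows "((\<Prod>j\<in>S. x j) - 1) / littlewood_denom (invert_on S x) I =
    (\<Sum>i\<in>S. (\<Prod>j\<in>S. x j) * x i ^ (card I - 1) /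
      ((\<Prod>j\<in>I - {i}. x i - x j) * littlewood_denom (invert_on S x) (I - {i})))"
proof -
  have finite_S: "finite S" using finite_subset[OF assms(3,1)] .
  have generic_S: "generic_on S x" using generic_on_subset[OF assms(2,3)] .
  have "(\<Sum>i\<in>S. (\<Prod>j\<in>S. x j) * x i ^ (card I - 1) /
      ((\<Prod>j\<in>I - {i}. x i - x j) * littlewood_denom (invert_on S x) (I - {i}))) =
      (\<Sum>i\<in>S. (x i - 1) * (\<Prod>j\<in>S - {i}. (x i * x j - 1) / (x i - x j))) /
        littlewood_denom (invert_on S x) I"
    unfolding sum_divide_distrib
    by (intro sum.cong refl prod_div_littlewood_denom_remove assms)
  also have "(\<Sum>i\<in>S. (x i - 1) * (\<Prod>j\<in>S - {i}. (x i * x j - 1) / (x i - x j))) =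
      \<Prod>(x ` S) - 1"
    using sum_prod_remove_reindex[OF generic_onD(1)[OF generic_S],
        of "\<lambda>a. a - 1" "\<lambda>a b. (a * b - 1) / (a - b)"]
      sum_prod_mult_minus_1_div_diff[of "x ` S"] generic_onD(2,5)[OF generic_S] finite_S
    by force
  also have "\<Prod>(x ` S) = (\<Prod>j\<in>S. x j)"
    using generic_onD(1)[OF generic_S] by (simp add: prod.reindex)
  finally show ?thesis ..
qed

lemma littlewood_summand_diff:
  fixes x :: "'i :: linorder \<Rightarrow> 'a :: field"
  assumes "finite I" and "generic_on I x" and "S \<subseteq> I"
  shows "littlewood_summand m x S I - littlewood_summand (m - 1) x S I =
    (\<Sum>i\<in>S. x i powi (m + int (card I) - 1) / (\<Prod>j\<in>I - {i}. x i - x j) *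
      littlewood_summand m x (S - {i}) (I - {i}))"
proof -
  note nonzero = generic_onD(2)[OF assms(2)]
  have prod_powi: "(\<Prod>j\<in>S. x j powi m) = (\<Prod>j\<in>S. x j powi (m - 1)) * (\<Prod>j\<in>S. x j)"
    unfolding prod.distrib[symmetric] using assms(3) nonzero
    by (intro prod.cong refl) (auto simp: power_int_minus_mult)
  have "littlewood_summand m x S I - littlewood_summand (m - 1) x S I =
      (\<Prod>j\<in>S. x j powi (m - 1)) * (((\<Prod>j\<in>S. x j) - 1) / littlewood_denom (invert_on S x) I)"
    by (simp add: littlewood_summand_def prod_powi right_diff_distrib diff_divide_distrib)
  also have "\<dots> = (\<Sum>i\<in>S. (\<Prod>j\<in>S. x j powi m) * x i ^ (card I - 1) /
      ((\<Prod>j\<in>I - {i}. x i - x j) * littlewood_denom (invert_on S x) (I - {i})))"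
    unfolding prod_minus_1_div_littlewood_denom[OF assms] sum_distrib_left prod_powi
    by (simp add: mult.assoc)
  also have "\<dots> = (\<Sum>i\<in>S. x i powi (m + int (card I) - 1) / (\<Prod>j\<in>I - {i}. x i - x j) *
      littlewood_summand m x (S - {i}) (I - {i}))"
  proof (intro sum.cong refl)
    fix i assume i: "i \<in> S"
    have "card I > 0" using i assms(1,3) by (auto simp: card_gt_0_iff)
    then have exponent: "m + int (card I) - 1 = m + int (card I - 1)" by simp
    have "x i \<noteq> 0" using nonzero i assms(3) by blast
    then have "x i powi (m + int (card I) - 1) = x i powi m * x i ^ (card I - 1)"
      unfolding exponent by (metis power_int_add power_int_of_nat)
    moreover have "littlewood_denom (invert_on (S - {i}) x) (I - {i}) =
        littlewood_denom (invert_on S x) (I - {i})"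
      by (rule littlewood_denom_cong) (simp add: invert_on_def)
    ultimately show "(\<Prod>j\<in>S. x j powi m) * x i ^ (card I - 1) /
        ((\<Prod>j\<in>I - {i}. x i - x j) * littlewood_denom (invert_on S x) (I - {i})) =
        x i powi (m + int (card I) - 1) / (\<Prod>j\<in>I - {i}. x i - x j) *
        littlewood_summand m x (S - {i}) (I - {i})"
      by (simp add: littlewood_summand_def prod.remove[OF finite_subset[OF assms(3,1)] i] mult_ac)
  qed
  finally show ?thesis .
qed

lemma bounded_littlewood_diff:
  fixes x :: "'i :: linorder \<Rightarrow> 'a :: field"
  assumes "finite I" and "generic_on I x"
  shows "bounded_littlewood m x I - bounded_littlewood (m - 1) x I =
    (\<Sum>i\<in>I. x i powi (m + int (card I) - 1) / (\<Prod>j\<in>I - {i}. x i - x j) *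
      bounded_littlewood m x (I - {i}))"
proof -
  have "bounded_littlewood m x I - bounded_littlewood (m - 1) x I =
      (\<Sum>S\<in>Pow I. \<Sum>i\<in>S. x i powi (m + int (card I) - 1) / (\<Prod>j\<in>I - {i}. x i - x j) *
        littlewood_summand m x (S - {i}) (I - {i}))"
    unfolding bounded_littlewood_def sum_subtractf[symmetric]
    by (intro sum.cong refl littlewood_summand_diff assms) auto
  also have "\<dots> = (\<Sum>i\<in>I. \<Sum>S\<in>Pow (I - {i}).
      x i powi (m + int (card I) - 1) / (\<Prod>j\<in>I - {i}. x i - x j) *
        littlewood_summand m x S (I - {i}))"
    by (rule sum_Pow_remove_swap[OF assms(1)])
  finally show ?thesis
    by (simp add: bounded_littlewood_def sum_distrib_left)
qed

section \<open>Alternants\<close>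

definition vandermonde :: "('i :: linorder \<Rightarrow> 'a :: comm_ring_1) \<Rightarrow> 'i set \<Rightarrow> 'a" where
  "vandermonde x I = pairs_prod (\<lambda>i j. x i - x j) I"

lemma vandermonde_nonzero:
  fixes x :: "'i :: linorder \<Rightarrow> 'a :: idom"
  assumes "finite I" and "inj_on x I"
  shows "vandermonde x I \<noteq> 0"
  unfolding vandermonde_def
  using assms by (intro pairs_prod_nonzero) (auto simp: inj_on_def)

lemma strict_mono_insert_index: "strict_mono (insert_index i)"
  by (auto simp: strict_mono_def insert_index_def)

lemma insert_index_image_lessThan:
  "i \<le> n \<Longrightarrow> insert_index i ` {..<n} = {..n} - {i}"
  using insert_index_image[of i n] by (simp add: atLeast0LessThan lessThan_Suc_atMost)

lemma vandermonde_remove: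
  assumes "i \<le> n"
  shows "vandermonde x {..n} =
    (-1) ^ i * (\<Prod>j\<in>{..n} - {i}. x i - x j) * vandermonde (x \<circ> insert_index i) {..<n}"
proof -
  have "{j \<in> {..n} - {i}. j < i} = {..<i}" using assms by auto
  then have sign: "(\<Prod>j\<in>{..n} - {i}. if j < i then -1 else 1) = (-1 :: 'a) ^ i"
    by (subst prod.inter_filter[symmetric]) auto
  have "(\<Prod>j\<in>{..n} - {i}. if j < i then x j - x i else x i - x j) =
      (\<Prod>j\<in>{..n} - {i}. (if j < i then -1 else 1) * (x i - x j))"
    by (intro prod.cong) auto
  moreover have "vandermonde x ({..n} - {i}) = vandermonde (x \<circ> insert_index i) {..<n}"
    unfolding vandermonde_def insert_index_image_lessThan[OF assms, symmetric]
      pairs_prod_reindex[OF strict_mono_insert_index] by simp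
  ultimately show ?thesis
    using pairs_prod_remove[of "{..n}" i "\<lambda>i j. x i - x j"] assms
    by (simp add: vandermonde_def prod.distrib sign)
qed

definition alternant :: "(nat \<Rightarrow> 'a :: comm_ring_1) \<Rightarrow> nat list \<Rightarrow> 'a" where
  "alternant x lam =
     det (mat (length lam) (length lam) (\<lambda>(i, j). x i ^ (lam ! j + length lam - Suc j)))"

lemma alternant_Cons:
  "alternant x (k # lam) =
    (\<Sum>i\<le>length lam. (-1) ^ i * x i ^ (k + length lam) * alternant (x \<circ> insert_index i) lam)"
proof -
  let ?n = "length lam"
  let ?A = "mat (Suc ?n) (Suc ?n) (\<lambda>(i, j). x i ^ ((k # lam) ! j + Suc ?n - Suc j))"
  have "mat_delete ?A i 0 =
      mat ?n ?n (\<lambda>(i', j). (x \<circ> insert_index i) i' ^ (lam ! j + ?n - Suc j))" if "i \<le> ?n" for i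
    using that by (intro eq_matI) (auto simp: mat_delete_def insert_index_def)
  then show ?thesis
    unfolding alternant_def
    by (subst laplace_expansion_column[of _ "Suc ?n" 0])
      (auto simp: cofactor_def lessThan_Suc_atMost mult_ac simp del: sum.lessThan_Suc
        intro!: sum.cong)
qed

definition bialternant :: "(nat \<Rightarrow> 'a :: field) \<Rightarrow> nat list \<Rightarrow> 'a" where
  "bialternant x lam = alternant x lam / vandermonde x {..<length lam}"

lemma bialternant_Nil: "bialternant x [] = 1"
  by (simp add: bialternant_def alternant_def vandermonde_def)

lemma bialternant_Cons:
  assumes "inj_on x {..length lam}"
  shows "bialternant x (k # lam) =
    (\<Sum>i\<le>length lam. x i ^ (k + length lam) / (\<Prod>j\<in>{..length lam} - {i}. x i - x j) *
      bialternant (x \<circ> insert_index i) lam)"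
  unfolding bialternant_def alternant_Cons sum_divide_distrib length_Cons lessThan_Suc_atMost
proof (intro sum.cong refl)
  fix i assume "i \<in> {..length lam}"
  then show "(-1) ^ i * x i ^ (k + length lam) * alternant (x \<circ> insert_index i) lam /
      vandermonde x {..length lam} =
      x i ^ (k + length lam) / (\<Prod>j\<in>{..length lam} - {i}. x i - x j) *
      (alternant (x \<circ> insert_index i) lam / vandermonde (x \<circ> insert_index i) {..<length lam})"
    by (simp add: vandermonde_remove[of i])
qed

lemma inj_on_comp_insert_index:
  assumes "inj_on x {..n}" and "i \<le> n"
  shows "inj_on (x \<circ> insert_index i) {..<n}"
  using assms by (intro comp_inj_on insert_index_inj_on)
    (auto simp: insert_index_image_lessThan intro: inj_on_subset)

lemma bialternant_replicate_0:
  "inj_on x {..<n} \<Longrightarrow> bialternant x (replicate n 0) = 1"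
proof (induction n arbitrary: x)
  case 0
  show ?case by (simp add: bialternant_Nil)
next
  case (Suc n)
  then have inj: "inj_on x {..n}" by (simp add: lessThan_Suc_atMost)
  then have "bialternant x (replicate (Suc n) 0) =
      (\<Sum>i\<le>n. x i ^ n / (\<Prod>j\<in>{..n} - {i}. x i - x j) *
        bialternant (x \<circ> insert_index i) (replicate n 0))"
    by (simp add: bialternant_Cons)
  also have "\<dots> = (\<Sum>i\<le>n. x i ^ n / (\<Prod>j\<in>{..n} - {i}. x i - x j))"
    by (intro sum.cong refl) (simp add: Suc.IH[OF inj_on_comp_insert_index[OF inj]])
  also have "\<dots> = 1"
    using sum_power_div_prod_diff[of "{..n}" x] inj by simp
  finally show ?case .
qed

section \<open>Determinants of differences of powers\<close>

lemma det_mat_eq_sum_permutes: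
  "det (mat n n (\<lambda>(i, j). a i j)) = (\<Sum>p | p permutes {..<n}. signof p * (\<Prod>i<n. a i (p i)))"
  by (subst det_def'[of _ n])
    (auto intro!: sum.cong prod.cong arg_cong2[of _ _ _ _ "(*)"]
      simp: atLeast0LessThan permutes_in_image)

lemma det_scale_rows:
  "det (mat n n (\<lambda>(i, j). c i * a i j)) = (\<Prod>i<n. c i) * det (mat n n (\<lambda>(i, j). a i j))"
  by (simp add: det_mat_eq_sum_permutes prod.distrib sum_distrib_left mult_ac)

lemma det_add_rows:
  "det (mat n n (\<lambda>(i, j). a i j + b i j)) =
    (\<Sum>S\<in>Pow {..<n}. det (mat n n (\<lambda>(i, j). if i \<in> S then a i j else b i j)))"
proof -
  have "(\<Prod>i<n. a i (p i) + b i (p i)) =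
      (\<Sum>S\<in>Pow {..<n}. \<Prod>i<n. if i \<in> S then a i (p i) else b i (p i))" for p
  proof (subst prod_add, simp, intro sum.cong refl)
    fix S assume "S \<in> Pow {..<n}"
    then have "{..<n} \<inter> {i. i \<in> S} = S" and "{..<n} \<inter> - {i. i \<in> S} = {..<n} - S" by auto
    then show "(\<Prod>i\<in>S. a i (p i)) * (\<Prod>i\<in>{..<n} - S. b i (p i)) =
        (\<Prod>i<n. if i \<in> S then a i (p i) else b i (p i))"
      by (simp add: prod.If_cases)
  qed
  then show ?thesis
    unfolding det_mat_eq_sum_permutes by (simp add: sum_distrib_left sum.swap[of _ "Pow {..<n}"])
qed

lemma det_vandermonde:
  fixes x :: "nat \<Rightarrow> 'a :: field"
  assumes "inj_on x {..<n}" and "\<And>i. i < n \<Longrightarrow> x i \<noteq> 0"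
  shows "det (mat n n (\<lambda>(i, j). x i ^ j)) = pairs_prod (\<lambda>i j. x j - x i) {..<n}"
proof -
  let ?y = "\<lambda>i. inverse (x i)"
  have inj: "inj_on ?y {..<n}" using assms(1) by (simp add: inj_on_def)
  have entry: "x i ^ j = x i ^ (n - 1) * ?y i ^ (replicate n 0 ! j + n - Suc j)"
    if "i < n" "j < n" for i j
  proof -
    have "n - 1 = j + (n - Suc j)" using that by simp
    then have "x i ^ (n - 1) = x i ^ j * x i ^ (n - Suc j)" by (metis power_add)
    then show ?thesis using that assms(2)[of i] by (simp add: power_inverse)
  qed
  have "mat n n (\<lambda>(i, j). x i ^ j) =
      mat n n (\<lambda>(i, j). x i ^ (n - 1) * ?y i ^ (replicate n 0 ! j + n - Suc j))"
    by (intro cong_mat refl, unfold split) (rule entry)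
  then have "det (mat n n (\<lambda>(i, j). x i ^ j)) =
      (\<Prod>i<n. x i ^ (n - 1)) * alternant ?y (replicate n 0)"
    by (simp add: det_scale_rows alternant_def)
  also have "alternant ?y (replicate n 0) = vandermonde ?y {..<n}"
    using bialternant_replicate_0[OF inj] vandermonde_nonzero[OF _ inj]
    by (simp add: bialternant_def)
  also have "(\<Prod>i<n. x i ^ (n - 1)) * vandermonde ?y {..<n} =
      pairs_prod (\<lambda>i j. x i * x j * (?y i - ?y j)) {..<n}"
    using pairs_prod_mult_separate[of "{..<n}" x] by (simp add: vandermonde_def pairs_prod_mult)
  also have "\<dots> = pairs_prod (\<lambda>i j. x j - x i) {..<n}"
  proof (rule pairs_prod_cong)
    fix i j assume "i \<in> {..<n}" and "j \<in> {..<n}"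
    then show "x i * x j * (?y i - ?y j) = x j - x i"
      using assms(2)[of i] assms(2)[of j] by (simp add: field_simps)
  qed
  finally show ?thesis .
qed

text \<open>Up to a monomial with half-integral exponents this is the Weyl denominator of type \<open>B\<^sub>n\<close>.\<close>

definition weyl_denom :: "('i :: linorder \<Rightarrow> 'a :: comm_ring_1) \<Rightarrow> 'i set \<Rightarrow> 'a" where
  "weyl_denom x I = pairs_prod (\<lambda>i j. x j - x i) I * littlewood_denom x I"

lemma weyl_denom_nonzero:
  assumes "finite I" and "generic_on I x"
  shows "weyl_denom x I \<noteq> 0"
proof -
  have "pairs_prod (\<lambda>i j. x j - x i) I \<noteq> 0"
    using generic_onD(1)[OF assms(2)] assms(1) by (intro pairs_prod_nonzero) (auto simp: inj_on_def)
  then show ?thesis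
    using littlewood_denom_nonzero[OF assms] by (simp add: weyl_denom_def)
qed

lemma weyl_denom_invert_on:
  fixes x :: "'i :: linorder \<Rightarrow> 'a :: field"
  assumes "finite I" and "S \<subseteq> I" and "\<And>i. i \<in> I \<Longrightarrow> x i \<noteq> 0"
  shows "(\<Prod>i\<in>S. - (x i ^ (2 * card I - 1))) * weyl_denom (invert_on S x) I = weyl_denom x I"
proof -
  let ?y = "invert_on S x"
  let ?sq = "\<lambda>i. if i \<in> S then x i ^ 2 else 1"
  have "(\<Prod>i\<in>S. - (x i ^ (2 * card I - 1))) =
      (\<Prod>i\<in>I. (if i \<in> S then - x i else 1) * ?sq i ^ (card I - 1))"
  proof -
    have "(\<Prod>i\<in>S. - (x i ^ (2 * card I - 1))) =
        (\<Prod>i\<in>I. if i \<in> S then - (x i ^ (2 * card I - 1)) else 1)"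
      using assms(1,2) by (simp add: Int_absorb1 flip: prod.inter_restrict)
    also have "\<dots> = (\<Prod>i\<in>I. (if i \<in> S then - x i else 1) * ?sq i ^ (card I - 1))"
    proof (intro prod.cong refl)
      fix i assume "i \<in> I"
      then have "card I > 0" using assms(1) by (auto simp: card_gt_0_iff)
      then have "2 * card I - 1 = Suc (2 * (card I - 1))" by simp
      then show "(if i \<in> S then - (x i ^ (2 * card I - 1)) else 1) =
          (if i \<in> S then - x i else 1) * ?sq i ^ (card I - 1)"
        by (simp add: power_mult)
    qed
    finally show ?thesis .
  qed
  also have "\<dots> = (\<Prod>i\<in>I. if i \<in> S then - x i else 1) * pairs_prod (\<lambda>i j. ?sq i * ?sq j) I"
    by (simp only: prod.distrib pairs_prod_mult_separate[OF assms(1)])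
  finally have "(\<Prod>i\<in>S. - (x i ^ (2 * card I - 1))) * weyl_denom ?y I =
      (\<Prod>i\<in>I. (if i \<in> S then - x i else 1) * (1 - ?y i)) *
      pairs_prod (\<lambda>i j. ?sq i * ?sq j * ((?y j - ?y i) * (1 - ?y i * ?y j))) I"
    by (simp add: weyl_denom_def littlewood_denom_def prod.distrib pairs_prod_mult mult_ac)
  also have "(\<Prod>i\<in>I. (if i \<in> S then - x i else 1) * (1 - ?y i)) = (\<Prod>i\<in>I. 1 - x i)"
    using assms(3) by (intro prod.cong) (auto simp: invert_on_def right_diff_distrib)
  also have "pairs_prod (\<lambda>i j. ?sq i * ?sq j * ((?y j - ?y i) * (1 - ?y i * ?y j))) I =
      pairs_prod (\<lambda>i j. (x j - x i) * (1 - x i * x j)) I"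
    using assms(3) by (intro pairs_prod_cong)
      (auto simp: invert_on_def field_simps power2_eq_square)
  finally show ?thesis
    by (simp add: weyl_denom_def littlewood_denom_def pairs_prod_mult mult_ac)
qed

lemma det_select_power_rows:
  fixes x :: "nat \<Rightarrow> 'a :: field"
  assumes "generic_on {..<n} x" and "n \<le> N" and "S \<subseteq> {..<n}"
  shows "det (mat n n (\<lambda>(i, j). if i \<in> S then - (x i ^ (N - Suc j)) else x i ^ j)) =
    weyl_denom x {..<n} * littlewood_summand (int N - 2 * int n) x S {..<n}"
proof -
  let ?y = "invert_on S x"
  note nonzero = generic_onD(2)[OF assms(1)]
  have generic_y: "generic_on {..<n} ?y" using assms(1) by (rule generic_on_invert_on)
  have entry: "(if i \<in> S then - (x i ^ (N - Suc j)) else x i ^ j) =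
      (if i \<in> S then - (x i ^ (N - 1)) else 1) * ?y i ^ j" if "i < n" "j < n" for i j
  proof -
    have "N - 1 = (N - Suc j) + j" using that assms(2) by simp
    then have "x i ^ (N - 1) = x i ^ (N - Suc j) * x i ^ j" by (metis power_add)
    then show ?thesis
      using that nonzero[of i] by (simp add: invert_on_def power_inverse)
  qed
  have "det (mat n n (\<lambda>(i, j). if i \<in> S then - (x i ^ (N - Suc j)) else x i ^ j)) =
      det (mat n n (\<lambda>(i, j). (if i \<in> S then - (x i ^ (N - 1)) else 1) * ?y i ^ j))"
    by (intro arg_cong[of _ _ det] eq_matI) (auto simp: entry)
  also have "\<dots> = (\<Prod>i\<in>S. - (x i ^ (N - 1))) * pairs_prod (\<lambda>i j. ?y j - ?y i) {..<n}"
    unfolding det_scale_rows using assms(3) generic_onD[OF generic_y]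
    by (subst det_vandermonde) (auto simp: Int_absorb1 simp flip: prod.inter_restrict)
  also have "pairs_prod (\<lambda>i j. ?y j - ?y i) {..<n} =
      weyl_denom ?y {..<n} / littlewood_denom ?y {..<n}"
    using littlewood_denom_nonzero[OF _ generic_y] by (simp add: weyl_denom_def)
  also have "(\<Prod>i\<in>S. - (x i ^ (N - 1))) =
      (\<Prod>i\<in>S. x i powi (int N - 2 * int n)) * (\<Prod>i\<in>S. - (x i ^ (2 * n - 1)))"
    unfolding prod.distrib[symmetric]
  proof (intro prod.cong refl)
    fix i assume "i \<in> S"
    then have i: "i < n" using assms(3) by auto
    then have "int (N - 1) = (int N - 2 * int n) + int (2 * n - 1)" using assms(2) by simp
    then have "x i ^ (N - 1) = x i powi (int N - 2 * int n) * x i ^ (2 * n - 1)"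
      using nonzero[of i] i by (metis lessThan_iff power_int_add power_int_of_nat)
    then show "- (x i ^ (N - 1)) = x i powi (int N - 2 * int n) * - (x i ^ (2 * n - 1))" by simp
  qed
  finally show ?thesis
    using weyl_denom_invert_on[OF _ assms(3) nonzero] by (simp add: littlewood_summand_def mult_ac)
qed

lemma det_power_diff:
  fixes x :: "nat \<Rightarrow> 'a :: field"
  assumes "generic_on {..<n} x" and "n \<le> N"
  shows "det (mat n n (\<lambda>(i, j). x i ^ j - x i ^ (N - Suc j))) =
    weyl_denom x {..<n} * bounded_littlewood (int N - 2 * int n) x {..<n}"
proof -
  have "det (mat n n (\<lambda>(i, j). x i ^ j - x i ^ (N - Suc j))) =
      det (mat n n (\<lambda>(i, j). - (x i ^ (N - Suc j)) + x i ^ j))" by simp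
  also have "\<dots> = (\<Sum>S\<in>Pow {..<n}.
      det (mat n n (\<lambda>(i, j). if i \<in> S then - (x i ^ (N - Suc j)) else x i ^ j)))"
    by (rule det_add_rows)
  finally show ?thesis
    by (simp add: bounded_littlewood_def sum_distrib_left det_select_power_rows[OF assms])
qed

text \<open>For \<open>m = -1\<close> the last column of the determinant vanishes.\<close>

lemma bounded_littlewood_minus_1:
  fixes x :: "nat \<Rightarrow> 'a :: field"
  assumes "generic_on {..n} x"
  shows "bounded_littlewood (-1) x {..n} = 0"
proof -
  let ?A = "mat (Suc n) (Suc n) (\<lambda>(i, j). x i ^ j - x i ^ (Suc (2 * n) - Suc j))"
  have "det ?A = (\<Sum>i<Suc n. ?A $$ (i, n) * cofactor ?A i n)"
    by (rule laplace_expansion_column) auto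
  also have "\<dots> = 0" by (intro sum.neutral) auto
  finally have "weyl_denom x {..n} * bounded_littlewood (-1) x {..n} = 0"
    using det_power_diff[of "Suc n" x "Suc (2 * n)"] assms by (simp add: lessThan_Suc_atMost)
  then show ?thesis using weyl_denom_nonzero[OF _ assms] by simp
qed

section \<open>Sums over partitions in a box\<close>

lemma finite_box_partitions: "finite (box_partitions m n)"
  by (rule finite_subset[OF _ finite_lists_length_eq[of "{..m}" n]]) (auto simp: box_partitions_def)

lemma length_box_partitions: "lam \<in> box_partitions m n \<Longrightarrow> length lam = n"
  by (simp add: box_partitions_def)

lemma box_partitions_0_right: "box_partitions m 0 = {[]}"
  by (auto simp: box_partitions_def)

lemma box_partitions_0_left: "box_partitions 0 n = {replicate n 0}"
  by (auto simp: box_partitions_def sorted_wrt_iff_nth_less intro!: replicate_eqI)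

lemma box_partitions_Suc: "box_partitions m (Suc n) = (\<Union>k\<le>m. (#) k ` box_partitions k n)"
  by (fastforce simp: box_partitions_def length_Suc_conv image_iff)

lemma sum_box_partitions_Suc:
  "(\<Sum>lam\<in>box_partitions m (Suc n). f lam) = (\<Sum>k\<le>m. \<Sum>lam\<in>box_partitions k n. f (k # lam))"
  unfolding box_partitions_Suc
  by (subst sum.UNION_disjoint) (auto simp: finite_box_partitions sum.reindex)

lemma generic_on_comp_insert_index:
  assumes "generic_on {..n} x" and "i \<le> n"
  shows "generic_on {..<n} (x \<circ> insert_index i)"
  using assms by (intro generic_on_reindex insert_index_inj_on)
    (auto simp: insert_index_image_lessThan intro: generic_on_subset)

lemma sum_bialternant_Cons:
  assumes "inj_on x {..n}"
  shows "(\<Sum>lam\<in>box_partitions m n. bialternant x (k # lam)) =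
    (\<Sum>i\<le>n. x i ^ (k + n) / (\<Prod>j\<in>{..n} - {i}. x i - x j) *
      (\<Sum>lam\<in>box_partitions m n. bialternant (x \<circ> insert_index i) lam))"
proof -
  have "(\<Sum>lam\<in>box_partitions m n. bialternant x (k # lam)) =
      (\<Sum>lam\<in>box_partitions m n. \<Sum>i\<le>n. x i ^ (k + n) / (\<Prod>j\<in>{..n} - {i}. x i - x j) *
        bialternant (x \<circ> insert_index i) lam)"
    using assms by (intro sum.cong refl) (auto simp: bialternant_Cons length_box_partitions)
  then show ?thesis
    unfolding sum_distrib_left by (simp only: sum.swap[of _ "{..n}"])
qed

lemma sum_bialternant_box_partitions:
  fixes x :: "nat \<Rightarrow> 'a :: field"
  assumes "generic_on {..<n} x"
  shows "(\<Sum>lam\<in>box_partitions m n. bialternant x lam) = bounded_littlewood (int m) x {..<n}"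
  using assms
proof (induction n arbitrary: m x)
  case 0
  show ?case
    by (simp add: box_partitions_0_right bialternant_Nil bounded_littlewood_def
        littlewood_summand_def littlewood_denom_def)
next
  case (Suc n)
  let ?H = "\<lambda>k. bounded_littlewood k x {..n}"
  have generic: "generic_on {..n} x" using Suc.prems by (simp add: lessThan_Suc_atMost)
  have first_part: "(\<Sum>lam\<in>box_partitions k n. bialternant x (k # lam)) =
      ?H (int k) - ?H (int k - 1)" for k
  proof -
    have "(\<Sum>lam\<in>box_partitions k n. bialternant (x \<circ> insert_index i) lam) =
        bounded_littlewood (int k) x ({..n} - {i})" if "i \<le> n" for i
      using Suc.IH[OF generic_on_comp_insert_index[OF generic that]]
        bounded_littlewood_reindex[OF strict_mono_insert_index, of "int k" x i "{..<n}"] that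
      by (simp add: insert_index_image_lessThan o_def)
    then show ?thesis
      unfolding sum_bialternant_Cons[OF generic_onD(1)[OF generic]]
        bounded_littlewood_diff[OF finite_atMost generic]
      by (intro sum.cong refl) (simp flip: of_nat_add)
  qed
  have "(\<Sum>lam\<in>box_partitions m (Suc n). bialternant x lam) =
      (\<Sum>k<Suc m. ?H (int (Suc k) - 1) - ?H (int k - 1))"
    by (simp add: sum_box_partitions_Suc first_part lessThan_Suc_atMost del: sum.lessThan_Suc)
  also have "\<dots> = ?H (int m) - ?H (-1)"
    using sum_lessThan_telescope[of "\<lambda>k. ?H (int k - 1)" "Suc m"] by simp
  also have "\<dots> = ?H (int m)"
    by (simp add: bounded_littlewood_minus_1[OF generic])
  finally show ?case by (simp add: lessThan_Suc_atMost)
qed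

lemma bounded_littlewood_0:
  fixes x :: "nat \<Rightarrow> 'a :: field"
  assumes "generic_on {..<n} x"
  shows "bounded_littlewood 0 x {..<n} = 1"
  using sum_bialternant_box_partitions[OF assms, of 0] generic_onD(1)[OF assms]
  by (simp add: box_partitions_0_left bialternant_replicate_0)

lemma schur_eq_bialternant:
  assumes "length lam = n"
  shows "schur n x lam = bialternant (x \<circ> Suc) lam"
proof -
  have "{(i, j). 1 \<le> i \<and> i < j \<and> j \<le> n} =
      {(i, j). i \<in> Suc ` {..<n} \<and> j \<in> Suc ` {..<n} \<and> i < j}"
    by (auto simp: image_Suc_lessThan)
  then have "(\<Prod>(i, j) \<in> {(i, j). 1 \<le> i \<and> i < j \<and> j \<le> n}. x i - x j) =
      pairs_prod (\<lambda>i j. x i - x j) (Suc ` {..<n})"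
    by (simp only: pairs_prod_def)
  also have "\<dots> = vandermonde (x \<circ> Suc) {..<n}"
    by (subst pairs_prod_reindex) (simp_all add: vandermonde_def strict_mono_def)
  finally show ?thesis
    using assms by (simp add: schur_def bialternant_def alternant_def det1_def part_def)
qed

theorem sum_schur_box_partitions:
  fixes x :: "nat \<Rightarrow> 'a :: field"
  assumes "generic_on {1..n} x"
  shows "(\<Sum>lam \<in> box_partitions m n. schur n x lam) =
    det1 n (\<lambda>i j. x i ^ (j - 1) - x i ^ (m + 2 * n - j)) /
    det1 n (\<lambda>i j. x i ^ (j - 1) - x i ^ (2 * n - j))"
proof -
  let ?y = "x \<circ> Suc"
  have generic: "generic_on {..<n} ?y"
    using assms by (intro generic_on_reindex) (simp_all add: image_Suc_lessThan)
  have "(\<Sum>lam \<in> box_partitions m n. schur n x lam) =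
      (\<Sum>lam \<in> box_partitions m n. bialternant ?y lam)"
    by (intro sum.cong refl) (simp add: schur_eq_bialternant length_box_partitions)
  also have "\<dots> = bounded_littlewood (int m) ?y {..<n}"
    using generic by (rule sum_bialternant_box_partitions)
  finally have sum_schur:
    "(\<Sum>lam \<in> box_partitions m n. schur n x lam) = bounded_littlewood (int m) ?y {..<n}" .
  have det: "det1 n (\<lambda>i j. x i ^ (j - 1) - x i ^ (k + 2 * n - j)) =
      weyl_denom ?y {..<n} * bounded_littlewood (int k) ?y {..<n}" for k
    using det_power_diff[OF generic, of "k + 2 * n"] by (simp add: det1_def)
  show ?thesis
    using det[of m] det[of 0] weyl_denom_nonzero[OF _ generic]
    by (simp add: sum_schur bounded_littlewood_0[OF generic])
qed

lemma single_eq_single_iff: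
  assumes "c \<noteq> 0"
  shows "Poly_Mapping.single a c = Poly_Mapping.single b c \<longleftrightarrow> a = b"
  using assms by (metis keys_single singleton_inject)

lemma generic_on_X: "generic_on I X"
proof -
  have "X i = X j \<longleftrightarrow> i = j" for i j
    by (simp add: X_def eq_fract single_eq_single_iff)
  moreover have "X i \<noteq> 0" for i
  proof -
    have "Poly_Mapping.single (Poly_Mapping.single i (1 :: nat)) (1 :: rat) \<noteq> 0"
      by (metis lookup_single_eq lookup_zero one_neq_zero)
    then show ?thesis by (simp add: X_def Zero_fract_def eq_fract)
  qed
  moreover have "X i * X j \<noteq> 1" for i j
  proof -
    have "Poly_Mapping.lookup (Poly_Mapping.single i (1 :: nat) + Poly_Mapping.single j 1) i \<noteq> 0"
      by (simp add: lookup_add)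
    then have "Poly_Mapping.single i (1 :: nat) + Poly_Mapping.single j 1 \<noteq> 0"
      by (metis lookup_zero)
    then have "Poly_Mapping.single (Poly_Mapping.single i (1 :: nat) + Poly_Mapping.single j 1)
        (1 :: rat) \<noteq> 1"
      by (metis single_eq_single_iff single_one zero_neq_one)
    then show ?thesis by (simp add: X_def One_fract_def eq_fract mult_single)
  qed
  ultimately show ?thesis by (auto simp: generic_on_def inj_on_def)
qed

theorem mainTheorem1:
  fixes m n :: nat
  assumes "m \<ge> 1" and "n \<ge> 1"
  shows "(\<Sum>lam \<in> box_partitions m n. schur n X lam) =
    det1 n (\<lambda>i j. X i ^ (j - 1) - X i ^ (m + 2 * n - j)) /
    det1 n (\<lambda>i j. X i ^ (j - 1) - X i ^ (2 * n - j))"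
  using generic_on_X by (rule sum_schur_box_partitions)

end
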